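(* Let $\mathcal H$ be a real Hilbert space, let $\mathcal J:\mathcal H\to\mathbb R\cup\{+\infty\}$ be proper, convex, lower semicontinuous and absolutely one-homogeneous, and let $u$ be the gradient flow of $\mathcal J$ with initial datum $f\in\overline{\mathrm{dom}(\mathcal J)}$ and limit $u_\infty$. Then the extinction time satisfies $$T_{\mathrm{ex}}\ge\mathcal J_*(f-u_\infty),\qquad\text{where }\ \mathcal J_*(\zeta):=\sup_{v\in\mathcal H,\ \mathcal J(v)\le1}\langle\zeta,v\rangle .$$
   Context: $\mathcal J$ is absolutely one-homogeneous if $\mathcal J(0)=0$ and $\mathcal J(cu)=|c|\mathcal J(u)$ for $c\ne0$; $\mathrm{dom}(\mathcal J)=\{\mathcal J<\infty\}$; $\partial\mathcal J$ is the convex subdifferential. The null space $\mathcal N_{\mathcal J}=\{\mathcal J=0\}$ is a closed linear subspace. The gradient flow with initial datum $f\in\overline{\mathrm{dom}(\mathcal J)}$ is the unique continuous map $u:[0,\infty)\to\mathcal H$ with $u(0)=f$, Lipschitz on $[\delta,\infty)$ for all $\delta>0$, right-differentiable on $(0,\infty)$, with $-\partial_t^+u(t)$ equal to the minimal-norm element of $\partial\mathcal J(u(t))$ for all $t>0$. The limit $u_\infty:=\lim_{t\to\infty}u(t)$ exists and equals the orthogonal projection of $f$ onto $\mathcal N_{\mathcal J}$. The extinction time is $T_{\mathrm{ex}}:=\inf\{t>0:u(t)=u_\infty\}\in[0,\infty]$ with $\inf\emptyset=\infty$. *)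

theory Defs
  imports "HOL-Analysis.Analysis"
begin

text \<open>Functionals on a real Hilbert space take values in \<^typ>\<open>ereal\<close>; the value
  \<open>-\<infinity>\<close> is excluded by properness.\<close>

definition proper_functional :: "('a \<Rightarrow> ereal) \<Rightarrow> bool" where
  "proper_functional J \<longleftrightarrow> (\<forall>x. J x \<noteq> -\<infinity>) \<and> (\<exists>x. J x < \<infinity>)"

definition convex_functional :: "('a::real_vector \<Rightarrow> ereal) \<Rightarrow> bool" where
  "convex_functional J \<longleftrightarrow> (\<forall>x y t. 0 < t \<and> t < 1 \<longrightarrow>
     J ((1 - t) *\<^sub>R x + t *\<^sub>R y) \<le> ereal (1 - t) * J x + ereal t * J y)"

definition lower_semicontinuous :: "('a::topological_space \<Rightarrow> ereal) \<Rightarrow> bool" where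
  "lower_semicontinuous J \<longleftrightarrow> (\<forall>x. J x \<le> Liminf (at x) J)"

definition abs_one_homogeneous :: "('a::real_vector \<Rightarrow> ereal) \<Rightarrow> bool" where
  "abs_one_homogeneous J \<longleftrightarrow>
     J 0 = 0 \<and> (\<forall>c u. c \<noteq> 0 \<longrightarrow> J (c *\<^sub>R u) = ereal \<bar>c\<bar> * J u)"

definition dom_functional :: "('a \<Rightarrow> ereal) \<Rightarrow> 'a set" where
  "dom_functional J = {u. J u < \<infinity>}"

text \<open>For proper \<open>J\<close> this set is empty outside the domain of \<open>J\<close>, as usual.\<close>

definition subdifferential :: "('a::real_inner \<Rightarrow> ereal) \<Rightarrow> 'a \<Rightarrow> 'a set" where
  "subdifferential J u = {p. \<forall>v. J u + ereal (p \<bullet> (v - u)) \<le> J v}"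

text \<open>Only the restriction of \<open>u\<close> to \<open>[0,\<infinity>)\<close> is constrained.\<close>

definition is_gradient_flow ::
  "('a::real_inner \<Rightarrow> ereal) \<Rightarrow> 'a \<Rightarrow> (real \<Rightarrow> 'a) \<Rightarrow> bool" where
  "is_gradient_flow J f u \<longleftrightarrow>
     continuous_on {0..} u \<and> u 0 = f \<and>
     (\<forall>\<delta>>0. \<exists>L. L-lipschitz_on {\<delta>..} u) \<and>
     (\<forall>t>0. \<exists>p. (u has_vector_derivative - p) (at_right t) \<and>
        is_arg_min norm (\<lambda>q. q \<in> subdifferential J (u t)) p)"

text \<open>The limit exists for every gradient flow of a proper, convex, lower semicontinuous and
  absolutely one-homogeneous functional; \<^const>\<open>Lim\<close> is unspecified for other \<open>u\<close>.\<close>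

definition flow_limit :: "(real \<Rightarrow> 'a::real_inner) \<Rightarrow> 'a" where
  "flow_limit u = Lim at_top u"

text \<open>The infimum is taken in \<^typ>\<open>ereal\<close>, so it is \<open>\<infinity>\<close> for the empty set.\<close>

definition extinction_time :: "(real \<Rightarrow> 'a::real_inner) \<Rightarrow> ereal" where
  "extinction_time u = Inf {ereal t |t. t > 0 \<and> u t = flow_limit u}"

definition dual_functional :: "('a::real_inner \<Rightarrow> ereal) \<Rightarrow> 'a \<Rightarrow> ereal" where
  "dual_functional J \<zeta> = (SUP v\<in>{v. J v \<le> 1}. ereal (\<zeta> \<bullet> v))"

end

theory Submission
  imports Defs
begin

text \<open>Fix a direction \<open>v\<close> with \<open>J v \<le> 1\<close>. Homogeneity turns the subgradient inequality at any
  point into the global bound \<open>p \<bullet> w \<le> J w\<close> (\<open>subgradient_inner_le\<close>): every subgradient lies in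
  the polar of the unit sublevel set of \<open>J\<close>. Along the flow the quantity \<open>- (u t \<bullet> v)\<close> has right
  derivative \<open>p \<bullet> v\<close> with \<open>p \<in> \<partial>J (u t)\<close>, so it grows at speed at most \<open>1\<close>, and a mean value
  inequality for right derivatives (\<open>right_derivative_le_imp_increment_le\<close>) integrates this to
  \<open>(f - u t) \<bullet> v \<le> t\<close>, that is, \<open>J\<^sub>* (f - u t) \<le> t\<close> for every \<open>t > 0\<close>. If the flow has reached
  its limit at time \<open>t\<close>, the left-hand side is \<open>J\<^sub>* (f - u\<^sub>\<infinity>)\<close>; the infimum over such \<open>t\<close> is the
  extinction time.\<close>

text \<open>The points \<open>t\<close> at which the increment over \<open>[a, t]\<close> obeys the bound with a slightly larger
  slope \<open>c + e\<close> form a closed set, which contains its supremum; were the supremum less than \<open>b\<close>,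
  the right derivative there would carry the bound a little further.\<close>

lemma right_derivative_le_imp_increment_le_closed:
  fixes g :: "real \<Rightarrow> real"
  assumes ab: "a \<le> b" and cont: "continuous_on {a..b} g"
    and der: "\<And>t. a \<le> t \<Longrightarrow> t < b \<Longrightarrow> (g has_real_derivative g' t) (at_right t)"
    and bound: "\<And>t. a \<le> t \<Longrightarrow> t < b \<Longrightarrow> g' t \<le> c"
  shows "g b - g a \<le> c * (b - a)"
proof -
  have slack: "g b - g a \<le> (c + e) * (b - a)" if e: "e > 0" for e
  proof -
    define h where "h = (\<lambda>t. g t - (c + e) * t)"
    define S where "S = {t \<in> {a..b}. h t \<le> h a}"
    have "continuous_on {a..b} h"
      unfolding h_def by (intro continuous_intros cont)
    then have "closed S"
      unfolding S_def by (intro continuous_on_closed_Collect_le) auto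
    moreover have aS: "a \<in> S" using ab by (simp add: S_def)
    moreover have bdd: "bdd_above S"
      by (rule bdd_aboveI[of _ b]) (simp add: S_def)
    ultimately have sS: "Sup S \<in> S"
      by (intro closed_contains_Sup) auto
    have "Sup S = b"
    proof (rule ccontr)
      assume "Sup S \<noteq> b"
      with sS have s: "a \<le> Sup S" "Sup S < b" and hs: "h (Sup S) \<le> h a"
        by (auto simp: S_def)
      have "(h has_real_derivative g' (Sup S) - (c + e)) (at_right (Sup S))"
        unfolding h_def by (intro DERIV_diff der s DERIV_cmult_Id)
      moreover have "g' (Sup S) - (c + e) < 0" using bound[OF s] e by simp
      ultimately obtain d where d: "d > 0"
          "\<And>x. x > 0 \<Longrightarrow> Sup S + x \<in> {Sup S<..} \<Longrightarrow> x < d \<Longrightarrow> h (Sup S + x) < h (Sup S)"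
        using has_real_derivative_neg_dec_right by blast
      define x where "x = min (d / 2) (b - Sup S)"
      have x: "x > 0" "x < d" "Sup S + x \<le> b"
        using d(1) s by (auto simp: x_def)
      have "h (Sup S + x) < h (Sup S)" using d(2) x by simp
      then have "Sup S + x \<in> S" using hs s x by (simp add: S_def)
      then have "Sup S + x \<le> Sup S" using bdd by (rule cSup_upper)
      with x show False by simp
    qed
    with sS show ?thesis by (simp add: S_def h_def algebra_simps)
  qed
  have "g b - g a \<le> c * (b - a) + e" if e: "e > 0" for e
  proof -
    have "g b - g a \<le> (c + e / (b - a + 1)) * (b - a)"
      using e ab by (intro slack) simp
    also have "\<dots> = c * (b - a) + e * ((b - a) / (b - a + 1))"
      by (simp add: algebra_simps)
    also have "\<dots> \<le> c * (b - a) + e"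
      using e ab by (intro add_left_mono mult_left_le) auto
    finally show ?thesis .
  qed
  then show ?thesis by (rule field_le_epsilon)
qed

text \<open>A bound on the right derivative in the open interval suffices, since the increment over
  \<open>[s, b]\<close> depends continuously on \<open>s\<close> down to \<open>s = a\<close>. For a gradient flow this matters: at time
  \<open>0\<close> only continuity is available.\<close>

lemma right_derivative_le_imp_increment_le:
  fixes g :: "real \<Rightarrow> real"
  assumes ab: "a < b" and cont: "continuous_on {a..b} g"
    and der: "\<And>t. a < t \<Longrightarrow> t < b \<Longrightarrow> (g has_real_derivative g' t) (at_right t)"
    and bound: "\<And>t. a < t \<Longrightarrow> t < b \<Longrightarrow> g' t \<le> c"
  shows "g b - g a \<le> c * (b - a)"
proof -
  define h where "h s = g b - g s - c * (b - s)" for s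
  have "continuous_on {a..b} h"
    unfolding h_def by (intro continuous_intros cont)
  then have "continuous_on (closure {a<..<b}) h"
    using ab by simp
  moreover have "a \<in> closure {a<..<b}"
    using ab by simp
  moreover have "h s \<le> 0" if "s \<in> {a<..<b}" for s
  proof -
    have "g b - g s \<le> c * (b - s)"
      using that der bound
      by (intro right_derivative_le_imp_increment_le_closed[where g' = g']
          continuous_on_subset[OF cont]) auto
    then show ?thesis by (simp add: h_def)
  qed
  ultimately have "h a \<le> 0"
    by (rule continuous_le_on_closure)
  then show ?thesis by (simp add: h_def)
qed

text \<open>Testing the subgradient inequality at \<open>u\<close> with \<open>c *\<^sub>R w\<close> and letting \<open>c \<rightarrow> \<infinity>\<close> leaves only the
  terms linear in \<open>c\<close>.\<close>

lemma subgradient_inner_le: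
  fixes J :: "'a::real_inner \<Rightarrow> ereal"
  assumes proper: "proper_functional J" and hom: "abs_one_homogeneous J"
    and p: "p \<in> subdifferential J u"
  shows "ereal (p \<bullet> w) \<le> J w"
proof (cases "J w")
  case (real r)
  have sub: "J u + ereal (p \<bullet> (v - u)) \<le> J v" for v
    using p by (simp add: subdifferential_def)
  have "J u \<noteq> -\<infinity>" using proper by (simp add: proper_functional_def)
  moreover have "J u \<noteq> \<infinity>"
    using sub[of 0] hom by (auto simp: abs_one_homogeneous_def)
  ultimately obtain j where j: "J u = ereal j" by (cases "J u") auto
  have scaled: "c * (p \<bullet> w - r) \<le> p \<bullet> u - j" if "c > 0" for c
  proof -
    have "J (c *\<^sub>R w) = ereal (c * r)"
      using hom that real by (simp add: abs_one_homogeneous_def)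
    with sub[of "c *\<^sub>R w"] j show ?thesis
      by (simp add: inner_diff_right algebra_simps)
  qed
  have "p \<bullet> w - r \<le> 0"
  proof (rule ccontr)
    assume "\<not> p \<bullet> w - r \<le> 0"
    then have pos: "p \<bullet> w - r > 0" by simp
    then have "(\<bar>p \<bullet> u - j\<bar> + 1) / (p \<bullet> w - r) * (p \<bullet> w - r) \<le> p \<bullet> u - j"
      by (intro scaled) simp
    with pos show False by simp
  qed
  with real show ?thesis by simp
next
  case MInf
  with proper show ?thesis by (simp add: proper_functional_def)
qed simp

lemma dual_functional_gradient_flow_le:
  fixes J :: "'a::real_inner \<Rightarrow> ereal"
  assumes proper: "proper_functional J" and hom: "abs_one_homogeneous J"
    and flow: "is_gradient_flow J f u" and T: "T > 0"
  shows "dual_functional J (f - u T) \<le> ereal T"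
  unfolding dual_functional_def
proof (rule SUP_least)
  fix v assume "v \<in> {v. J v \<le> 1}"
  then have v: "J v \<le> 1" by simp
  have u0: "u 0 = f" and cont: "continuous_on {0..} u"
    using flow by (simp_all add: is_gradient_flow_def)
  have "\<exists>p. (u has_vector_derivative - p) (at_right t) \<and> p \<in> subdifferential J (u t)"
    if "t > 0" for t
    using flow that by (auto simp: is_gradient_flow_def is_arg_min_def)
  then obtain p where
    p: "\<And>t. t > 0 \<Longrightarrow> (u has_vector_derivative - p t) (at_right t)"
      "\<And>t. t > 0 \<Longrightarrow> p t \<in> subdifferential J (u t)"
    by metis
  have "- (u T \<bullet> v) - - (u 0 \<bullet> v) \<le> 1 * (T - 0)"
  proof (rule right_derivative_le_imp_increment_le[where g' = "\<lambda>t. p t \<bullet> v"])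
    show "continuous_on {0..T} (\<lambda>t. - (u t \<bullet> v))"
      by (intro continuous_intros continuous_on_subset[OF cont]) auto
    fix t :: real assume t: "0 < t"
    have "((\<lambda>t. - (u t \<bullet> v)) has_vector_derivative - (- p t \<bullet> v)) (at_right t)"
      by (intro has_vector_derivative_minus p(1)[OF t]
          bounded_linear.has_vector_derivative[OF bounded_linear_inner_left])
    then show "((\<lambda>t. - (u t \<bullet> v)) has_real_derivative p t \<bullet> v) (at_right t)"
      by (simp add: has_real_derivative_iff_has_vector_derivative)
    have "ereal (p t \<bullet> v) \<le> 1"
      using subgradient_inner_le[OF proper hom p(2)[OF t]] v by (rule order_trans)
    then show "p t \<bullet> v \<le> 1" by simp
  qed (rule T)
  then show "ereal ((f - u T) \<bullet> v) \<le> ereal T"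
    by (simp add: u0 inner_diff_left)
qed

theorem proposition2p65:
  fixes J :: "'a::{real_inner, complete_space} \<Rightarrow> ereal"
    and f :: 'a and u :: "real \<Rightarrow> 'a"
  assumes "proper_functional J"
    and "convex_functional J"
    and "lower_semicontinuous J"
    and "abs_one_homogeneous J"
    and "f \<in> closure (dom_functional J)"
    and "is_gradient_flow J f u"
  shows "extinction_time u \<ge> dual_functional J (f - flow_limit u)"
  unfolding extinction_time_def
proof (rule Inf_greatest)
  fix x assume "x \<in> {ereal t |t. t > 0 \<and> u t = flow_limit u}"
  then obtain t where t: "x = ereal t" "t > 0" "u t = flow_limit u" by blast
  show "dual_functional J (f - flow_limit u) \<le> x"
    using dual_functional_gradient_flow_le[OF assms(1,4,6) t(2)] t by simp
qed

end
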